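(* The toroidal polyhex $H(p,q,t)$ has exactly $2^{q}+2^{p/g}+2^{p/g'}-3$ trivial perfect matchings, where $g$ (resp. $g'$) is the smallest positive integer satisfying $gt\equiv 0\pmod p$ (resp. $g'(q+t)\equiv 0 \pmod p$).
   Context: Toroidal polyhex: consider the regular hexagonal lattice in the plane with one of its three edge-directions vertical. Use affine coordinates with origin at the centre of a hexagon, horizontal $x$-axis, $y$-axis at angle $60^\circ$ to it, and unit length the distance between two parallel edges of a hexagon, so that hexagon centres are exactly the integer points. For integers $p,q\ge 2$ and $t$, $H(p,q,t)$ is obtained from the $p\times q$-parallelogram $P$ with corners $(0,0),(p,0),(p,q),(0,q)$ by identifying its two lateral sides and then identifying its top side with its bottom side after a twist of $t$ hexagons; equivalently, it is the quotient of the hexagonal lattice by the translation group generated by $(p,0)$ and $(t,q)$. It is a cubic bipartite graph embedded in the torus with all faces hexagons. A perfect matching $M$ of $H(p,q,t)$ is trivial if no hexagonal face of $H(p,q,t)$ is $M$-alternating (i.e. has its edges alternately in $M$ and not in $M$). *)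

theory Defs
  imports Complex_Main "HOL-Library.Product_Plus" "HOL-Number_Theory.Cong"
begin

(* A pair (x, y) stands for the affine coordinates with respect to a horizontal x-axis and a
   y-axis at 60 degrees to it.  Unit length is the distance between parallel edges of a hexagon,
   so the hexagon centres are exactly the integer points. *)
type_synonym point = "real \<times> real"

(* Corners of the hexagon centred at (i, j), counterclockwise: in Euclidean terms they lie at
   distance 1 / sqrt 3 from the centre, in the directions 30, 90, 150, 210, 270, 330 degrees.
   Edges 2 and 5 below (150-210 and 330-30 degrees) are the vertical ones. *)
definition hex_corner :: "int \<Rightarrow> int \<Rightarrow> nat \<Rightarrow> point" where
  "hex_corner i j k = (of_int i, of_int j) +
     [(1/3, 1/3), (-1/3, 2/3), (-2/3, 1/3), (-1/3, -1/3), (1/3, -2/3), (2/3, -1/3)] ! (k mod 6)"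

definition hex_side :: "int \<Rightarrow> int \<Rightarrow> nat \<Rightarrow> point set" where
  "hex_side i j k = {hex_corner i j k, hex_corner i j (Suc k)}"

definition hex_vertices :: "point set" where
  "hex_vertices = {hex_corner i j k |i j k. k < 6}"

definition hex_edges :: "point set set" where
  "hex_edges = {hex_side i j k |i j k. k < 6}"

(* The orbit of v under the translation group generated by (p, 0) and (t, q). *)
definition tp_orbit :: "nat \<Rightarrow> nat \<Rightarrow> int \<Rightarrow> point \<Rightarrow> point set" where
  "tp_orbit p q t v = {v + (of_int (a * int p + b * t), of_int (b * int q)) |a b. True}"

(* For p, q >= 2 the quotient has neither loops nor parallel edges, so its edges can be
   represented by their two-element sets of end vertices. *)
definition tp_vertices :: "nat \<Rightarrow> nat \<Rightarrow> int \<Rightarrow> point set set" where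
  "tp_vertices p q t = tp_orbit p q t ` hex_vertices"

definition tp_edges :: "nat \<Rightarrow> nat \<Rightarrow> int \<Rightarrow> point set set set" where
  "tp_edges p q t = (\<lambda>e. tp_orbit p q t ` e) ` hex_edges"

(* The faces of the quotient are the images of the lattice hexagons; a face is described by the
   cyclic sequence of its edges k = 0, ..., 5 (translation-equivalent centres give the same face). *)
definition face_edge :: "nat \<Rightarrow> nat \<Rightarrow> int \<Rightarrow> int \<Rightarrow> int \<Rightarrow> nat \<Rightarrow> point set set" where
  "face_edge p q t i j k = tp_orbit p q t ` hex_side i j k"

definition perfect_matching :: "'v set \<Rightarrow> 'v set set \<Rightarrow> 'v set set \<Rightarrow> bool" where
  "perfect_matching V E M \<longleftrightarrow> M \<subseteq> E \<and> (\<forall>v\<in>V. \<exists>!e. e \<in> M \<and> v \<in> e)"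

definition alternating_face ::
    "nat \<Rightarrow> nat \<Rightarrow> int \<Rightarrow> point set set set \<Rightarrow> int \<Rightarrow> int \<Rightarrow> bool" where
  "alternating_face p q t M i j \<longleftrightarrow>
     (\<forall>k<6. face_edge p q t i j k \<in> M \<longleftrightarrow> face_edge p q t i j (Suc k mod 6) \<notin> M)"

definition trivial_perfect_matching ::
    "nat \<Rightarrow> nat \<Rightarrow> int \<Rightarrow> point set set set \<Rightarrow> bool" where
  "trivial_perfect_matching p q t M \<longleftrightarrow>
     perfect_matching (tp_vertices p q t) (tp_edges p q t) M \<and>
     (\<forall>i j. \<not> alternating_face p q t M i j)"

end

theory Submission
  imports Defs
begin

text \<open>
  The lattice has two classes of vertices, one of each per unit cell of \<open>\<int>\<^sup>2\<close>. A vertex of the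
  first class has its three edges pointing at 30, 150 and 270 degrees, and a perfect matching
  chooses one of them at each such vertex. So perfect matchings of the quotient are the fields
  \<open>f\<close> of directions on \<open>\<int>\<^sup>2\<close> that are periodic under the translation lattice and for which every
  vertex of the second class is chosen exactly once (\<open>bij_betw_edges_of\<close>). Whether the hexagon
  centred at \<open>(i, j)\<close> is alternating depends only on \<open>f\<close> at \<open>(i, j)\<close>, \<open>(i - 1, j)\<close> and
  \<open>(i, j - 1)\<close>, and alternation requires all three directions there.

  The heart of the proof is that a periodic matching without alternating hexagon omits a direction
  everywhere (\<open>unflippable_iff_misses_dir\<close>). If somewhere in a row direction \<open>S\<close> is
  followed by \<open>NW\<close>, then the absence of alternating hexagons forces the same pair one step further
  down the antidiagonal, hence along a whole antidiagonal, which is then free of \<open>NE\<close>.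
  Freedom from \<open>NE\<close> passes from one antidiagonal to the next, and by periodicity to all.
  Otherwise each row that contains \<open>NW\<close> consists of \<open>NW\<close> only, so a row with
  \<open>NW\<close> is free of \<open>S\<close>; this passes from row to row, so \<open>S\<close> or \<open>NW\<close> never occurs.

  A matching that omits a direction is constant along the lines parallel to one axis: rows,
  columns or antidiagonals, when \<open>S\<close>, \<open>NW\<close> or \<open>NE\<close> is omitted. Conversely, choosing freely
  one of the two remaining directions on each line gives a matching, and a periodic choice is a
  periodic subset of \<open>\<int>\<close> with period \<open>q\<close>, \<open>gcd p t\<close> or \<open>gcd p (q + t)\<close>. These gcds are the quotients
  \<open>p / g\<close> and \<open>p / g'\<close> (\<open>div_least_annihilator\<close>). The three families meet pairwise in one
  constant field each and have no common member, so inclusion-exclusion subtracts 3.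
\<close>

section \<open>Lattice coordinates\<close>

text \<open>The directions of the three edges at a vertex of the first class, at 30, 150 and 270 degrees.\<close>
datatype dir = NE | NW | S

text \<open>The edge in direction \<open>d\<close> leaves the cell of its first-class end \<open>up i j\<close> for the cell
  \<open>(i - dx d, j - dy d)\<close> of its second-class end.\<close>
fun dx :: "dir \<Rightarrow> int" where
  "dx NE = 0" | "dx NW = 1" | "dx S = 0"

fun dy :: "dir \<Rightarrow> int" where
  "dy NE = 0" | "dy NW = 0" | "dy S = 1"

definition up :: "int \<Rightarrow> int \<Rightarrow> point" where
  "up i j = (of_int i + 1/3, of_int j + 1/3)"

definition dn :: "int \<Rightarrow> int \<Rightarrow> point" where
  "dn i j = (of_int i + 2/3, of_int j + 2/3)"

lemma hex_corners:
  "hex_corner i j 0 = up i j"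
  "hex_corner i j (Suc 0) = dn (i - 1) j"
  "hex_corner i j 2 = up (i - 1) j"
  "hex_corner i j 3 = dn (i - 1) (j - 1)"
  "hex_corner i j 4 = up i (j - 1)"
  "hex_corner i j 5 = dn i (j - 1)"
  "hex_corner i j 6 = up i j"
  by (simp_all add: hex_corner_def up_def dn_def)

lemma less_6_iff: "k < 6 \<longleftrightarrow> k \<in> {0, Suc 0, 2, 3, 4, 5 :: nat}"
  by auto

lemma hex_vertices_eq: "hex_vertices = {up i j | i j. True} \<union> {dn i j | i j. True}"
proof (intro equalityI subsetI)
  fix v assume "v \<in> hex_vertices"
  then obtain i j k where "v = hex_corner i j k" "k < 6"
    unfolding hex_vertices_def by blast
  then show "v \<in> {up i j | i j. True} \<union> {dn i j | i j. True}"
    unfolding less_6_iff by (elim insertE emptyE; simp add: hex_corners; blast)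
next
  have "up i j \<in> hex_vertices" for i j
    unfolding hex_vertices_def mem_Collect_eq
    by (intro exI[of _ i] exI[of _ j] exI[of _ "0::nat"]) (simp add: hex_corners)
  moreover have "dn i j \<in> hex_vertices" for i j
    unfolding hex_vertices_def mem_Collect_eq
    by (intro exI[of _ "i + 1"] exI[of _ j] exI[of _ "Suc 0"]) (simp add: hex_corners)
  ultimately show "v \<in> hex_vertices" if "v \<in> {up i j | i j. True} \<union> {dn i j | i j. True}" for v
    using that by auto
qed

definition link :: "int \<Rightarrow> int \<Rightarrow> dir \<Rightarrow> point set" where
  "link i j d = {up i j, dn (i - dx d) (j - dy d)}"

lemma hex_sides:
  "hex_side i j 0 = link i j NW"
  "hex_side i j (Suc 0) = link (i - 1) j NE"
  "hex_side i j 2 = link (i - 1) j S"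
  "hex_side i j 3 = link i (j - 1) NW"
  "hex_side i j 4 = link i (j - 1) NE"
  "hex_side i j 5 = link i j S"
  using hex_corners(3)[of i j, unfolded numeral_2_eq_2]
  by (simp_all add: hex_side_def link_def hex_corners insert_commute)

lemma hex_edges_eq: "hex_edges = {link i j d | i j d. True}"
proof (intro equalityI subsetI)
  fix e assume "e \<in> hex_edges"
  then obtain i j k where "e = hex_side i j k" "k < 6"
    unfolding hex_edges_def by blast
  then show "e \<in> {link i j d | i j d. True}"
    unfolding less_6_iff by (elim insertE emptyE; simp add: hex_sides; blast)
next
  fix e assume "e \<in> {link i j d | i j d. True}"
  then obtain i j d where e: "e = link i j d" by blast
  have "\<exists>i' j' k. e = hex_side i' j' k \<and> k < 6"
  proof (cases d)
    case NE
    then have "e = hex_side (i + 1) j (Suc 0)" by (simp add: e hex_sides)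
    moreover have "Suc 0 < 6" by simp
    ultimately show ?thesis by blast
  next
    case NW
    then have "e = hex_side i j 0" by (simp add: e hex_sides)
    moreover have "(0::nat) < 6" by simp
    ultimately show ?thesis by blast
  next
    case S
    then have "e = hex_side i j 5" by (simp add: e hex_sides)
    moreover have "(5::nat) < 6" by simp
    ultimately show ?thesis by blast
  qed
  then show "e \<in> hex_edges" unfolding hex_edges_def by blast
qed

locale polyhex =
  fixes p q :: nat and t :: int
  assumes p2: "p \<ge> 2" and q2: "q \<ge> 2"
begin

section \<open>Vertices and edges of the quotient\<close>

abbreviation orb :: "point \<Rightarrow> point set" where
  "orb \<equiv> tp_orbit p q t"

text \<open>Congruence modulo the translation group, for points of \<open>\<int>\<^sup>2\<close>.\<close>
definition lat_equiv :: "int \<Rightarrow> int \<Rightarrow> int \<Rightarrow> int \<Rightarrow> bool" where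
  "lat_equiv i j i' j' \<longleftrightarrow> (\<exists>a b. i' = i + (a * int p + b * t) \<and> j' = j + b * int q)"

lemma lat_equiv_refl: "lat_equiv i j i j"
  unfolding lat_equiv_def by (intro exI[of _ 0]) simp

lemma orb_eq_iff:
  "orb v = orb w \<longleftrightarrow> (\<exists>a b. w = v + (of_int (a * int p + b * t), of_int (b * int q)))"
proof
  assume "orb v = orb w"
  moreover have "w \<in> orb w"
    unfolding tp_orbit_def mem_Collect_eq by (intro exI[of _ 0]) (simp add: zero_prod_def[symmetric])
  ultimately have "w \<in> orb v" by simp
  then show "\<exists>a b. w = v + (of_int (a * int p + b * t), of_int (b * int q))"
    unfolding tp_orbit_def by blast
next
  assume "\<exists>a b. w = v + (of_int (a * int p + b * t), of_int (b * int q))"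
  then obtain a b where w: "w = v + (of_int (a * int p + b * t), of_int (b * int q))" by blast
  show "orb v = orb w"
  proof (intro equalityI subsetI)
    fix x assume "x \<in> orb v"
    then obtain c e where "x = v + (of_int (c * int p + e * t), of_int (e * int q))"
      unfolding tp_orbit_def by blast
    then have "x = w + (of_int ((c - a) * int p + (e - b) * t), of_int ((e - b) * int q))"
      by (cases v) (simp add: w algebra_simps)
    then show "x \<in> orb w" unfolding tp_orbit_def by blast
  next
    fix x assume "x \<in> orb w"
    then obtain c e where "x = w + (of_int (c * int p + e * t), of_int (e * int q))"
      unfolding tp_orbit_def by blast
    then have "x = v + (of_int ((c + a) * int p + (e + b) * t), of_int ((e + b) * int q))"
      by (cases v) (simp add: w algebra_simps)
    then show "x \<in> orb v" unfolding tp_orbit_def by blast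
  qed
qed

lemma of_int_shift: "of_int i' + c = of_int i + c + of_int n \<longleftrightarrow> i' = i + n" for c :: real
proof -
  have "of_int i' + c = of_int i + c + of_int n \<longleftrightarrow> (of_int i' :: real) = of_int (i + n)"
    by auto
  then show ?thesis by (simp only: of_int_eq_iff)
qed

lemma orb_up_eq_iff: "orb (up i j) = orb (up i' j') \<longleftrightarrow> lat_equiv i j i' j'"
  unfolding orb_eq_iff up_def lat_equiv_def add_Pair prod.inject of_int_shift ..

lemma orb_dn_eq_iff: "orb (dn i j) = orb (dn i' j') \<longleftrightarrow> lat_equiv i j i' j'"
  unfolding orb_eq_iff dn_def lat_equiv_def add_Pair prod.inject of_int_shift ..

text \<open>The first coordinates of the two classes of vertices lie in different classes modulo 1.\<close>
lemma orb_up_neq_dn: "orb (up i j) \<noteq> orb (dn i' j')"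
proof
  assume "orb (up i j) = orb (dn i' j')"
  then obtain n :: int where "of_int i' + 2/3 = of_int i + 1/3 + (of_int n :: real)"
    unfolding orb_eq_iff up_def dn_def add_Pair prod.inject by blast
  then have "of_int (3 * i' + 1) = (of_int (3 * i + 3 * n) :: real)" by simp
  then have "3 * i' + 1 = 3 * i + 3 * n" by (simp only: of_int_eq_iff)
  then show False by presburger
qed

lemma lat_equiv_sym: "lat_equiv i j i' j' \<longleftrightarrow> lat_equiv i' j' i j"
  using orb_up_eq_iff by metis

lemma lat_equiv_shift: "lat_equiv (i + c) (j + d) (i' + c) (j' + d) \<longleftrightarrow> lat_equiv i j i' j'"
  unfolding lat_equiv_def by (simp add: algebra_simps)

definition edge :: "int \<Rightarrow> int \<Rightarrow> dir \<Rightarrow> point set set" where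
  "edge i j d = orb ` link i j d"

lemma edge_doubleton: "edge i j d = {orb (up i j), orb (dn (i - dx d) (j - dy d))}"
  by (simp add: edge_def link_def)

text \<open>This is the absence of parallel edges in the quotient: two different directions differ by a
  nonzero vector with entries of absolute value at most 1, which is no period as \<open>p, q \<ge> 2\<close>.\<close>
lemma lat_equiv_dir_unique:
  assumes "lat_equiv i j i' j'" "lat_equiv (i - dx d) (j - dy d) (i' - dx d') (j' - dy d')"
  shows "d = d'"
proof -
  obtain a b where ab: "i' = i + (a * int p + b * t)" "j' = j + b * int q"
    using assms(1) unfolding lat_equiv_def by blast
  obtain a' b' where ab': "i' - dx d' = i - dx d + (a' * int p + b' * t)"
      "j' - dy d' = j - dy d + b' * int q"
    using assms(2) unfolding lat_equiv_def by blast
  have *: "n = 0" if "\<bar>n * int m\<bar> \<le> 1" "m \<ge> 2" for n :: int and m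
  proof (rule ccontr)
    assume "n \<noteq> 0"
    then have "\<bar>n\<bar> * int m \<ge> 1 * 2" using that(2) by (intro mult_mono) auto
    then show False using that(1) by (simp add: abs_mult)
  qed
  have "(b - b') * int q = dy d' - dy d"
    using ab(2) ab'(2) by (simp add: algebra_simps)
  moreover have "\<bar>dy d' - dy d\<bar> \<le> 1" by (cases d; cases d') auto
  ultimately have b: "b = b'" using *[of "b - b'" q] q2 by simp
  have "(a - a') * int p = dx d' - dx d"
    using ab(1) ab'(1) b by (simp add: algebra_simps)
  moreover have "\<bar>dx d' - dx d\<bar> \<le> 1" by (cases d; cases d') auto
  ultimately have a: "a = a'" using *[of "a - a'" p] p2 by simp
  have "dx d = dx d'" "dy d = dy d'" using ab ab' a b by simp_all
  then show "d = d'" by (cases d; cases d') auto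
qed

lemma edge_eq_iff: "edge i j d = edge i' j' d' \<longleftrightarrow> lat_equiv i j i' j' \<and> d = d'"
proof
  assume "edge i j d = edge i' j' d'"
  then have "lat_equiv i j i' j'" "lat_equiv (i - dx d) (j - dy d) (i' - dx d') (j' - dy d')"
    unfolding edge_doubleton doubleton_eq_iff orb_up_eq_iff orb_dn_eq_iff
    using orb_up_neq_dn by blast+
  then show "lat_equiv i j i' j' \<and> d = d'" using lat_equiv_dir_unique by blast
next
  assume "lat_equiv i j i' j' \<and> d = d'"
  then show "edge i j d = edge i' j' d'"
    using lat_equiv_shift[of i "- dx d" j "- dy d" i' j']
    unfolding edge_doubleton doubleton_eq_iff orb_up_eq_iff orb_dn_eq_iff by simp
qed

lemma up_in_edge_iff: "orb (up i j) \<in> edge i' j' d \<longleftrightarrow> lat_equiv i' j' i j"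
  using orb_up_neq_dn[of i j] orb_up_eq_iff[of i j i' j'] lat_equiv_sym[of i j i' j']
  by (simp add: edge_doubleton)

lemma dn_in_edge_iff: "orb (dn i j) \<in> edge i' j' d \<longleftrightarrow> lat_equiv i' j' (i + dx d) (j + dy d)"
  using orb_up_neq_dn[of i' j' i j] orb_dn_eq_iff[of i j "i' - dx d" "j' - dy d"]
    lat_equiv_sym[of i j "i' - dx d" "j' - dy d"] lat_equiv_shift[of "i' - dx d" "dx d" "j' - dy d" "dy d" i j]
  by (auto simp: edge_doubleton)

lemma tp_vertices_eq:
  "tp_vertices p q t = {orb (up i j) | i j. True} \<union> {orb (dn i j) | i j. True}"
  unfolding tp_vertices_def hex_vertices_eq by blast

lemma tp_edges_eq: "tp_edges p q t = {edge i j d | i j d. True}"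
  unfolding tp_edges_def hex_edges_eq edge_def by blast

lemma Ex1_reindex:
  assumes "inj h" "\<And>e. P e \<longleftrightarrow> (\<exists>d. e = h d \<and> Q d)"
  shows "(\<exists>!e. P e) \<longleftrightarrow> (\<exists>!d. Q d)"
  using assms unfolding inj_def by metis

text \<open>The covering conditions at the two classes of vertices, with the edges at a vertex
  enumerated by their directions.\<close>
lemma perfect_matching_iff:
  "perfect_matching (tp_vertices p q t) (tp_edges p q t) M \<longleftrightarrow>
     M \<subseteq> tp_edges p q t \<and> (\<forall>i j. \<exists>!d. edge i j d \<in> M) \<and>
     (\<forall>i j. \<exists>!d. edge (i + dx d) (j + dy d) d \<in> M)"
proof (cases "M \<subseteq> tp_edges p q t")
  case True
  have "(\<exists>!e. e \<in> M \<and> orb (up i j) \<in> e) \<longleftrightarrow> (\<exists>!d. edge i j d \<in> M)" for i j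
  proof (rule Ex1_reindex)
    show "inj (edge i j)" by (simp add: inj_def edge_eq_iff)
    show "(e \<in> M \<and> orb (up i j) \<in> e) \<longleftrightarrow> (\<exists>d. e = edge i j d \<and> edge i j d \<in> M)" for e
    proof
      assume e: "e \<in> M \<and> orb (up i j) \<in> e"
      then obtain i' j' d where d: "e = edge i' j' d" using True unfolding tp_edges_eq by blast
      then have "e = edge i j d" using e by (simp add: up_in_edge_iff edge_eq_iff)
      then show "\<exists>d. e = edge i j d \<and> edge i j d \<in> M" using e by blast
    qed (auto simp: up_in_edge_iff lat_equiv_refl)
  qed
  moreover have "(\<exists>!e. e \<in> M \<and> orb (dn i j) \<in> e) \<longleftrightarrow>
      (\<exists>!d. edge (i + dx d) (j + dy d) d \<in> M)" for i j
  proof (rule Ex1_reindex)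
    show "inj (\<lambda>d. edge (i + dx d) (j + dy d) d)" by (simp add: inj_def edge_eq_iff)
    show "(e \<in> M \<and> orb (dn i j) \<in> e) \<longleftrightarrow>
        (\<exists>d. e = edge (i + dx d) (j + dy d) d \<and> edge (i + dx d) (j + dy d) d \<in> M)" for e
    proof
      assume e: "e \<in> M \<and> orb (dn i j) \<in> e"
      then obtain i' j' d where d: "e = edge i' j' d" using True unfolding tp_edges_eq by blast
      then have "e = edge (i + dx d) (j + dy d) d"
        using e by (simp add: dn_in_edge_iff edge_eq_iff)
      then show "\<exists>d. e = edge (i + dx d) (j + dy d) d \<and> edge (i + dx d) (j + dy d) d \<in> M"
        using e by blast
    qed (auto simp: dn_in_edge_iff lat_equiv_refl)
  qed
  moreover have "(\<forall>v \<in> tp_vertices p q t. P v) \<longleftrightarrow>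
      (\<forall>i j. P (orb (up i j))) \<and> (\<forall>i j. P (orb (dn i j)))" for P
    unfolding tp_vertices_eq ball_Un by blast
  ultimately show ?thesis
    using True unfolding perfect_matching_def by simp
qed (simp add: perfect_matching_def)

section \<open>Matchings as direction fields\<close>

definition periodic :: "(int \<Rightarrow> int \<Rightarrow> dir) \<Rightarrow> bool" where
  "periodic f \<longleftrightarrow> (\<forall>i j. f (i + int p) j = f i j \<and> f (i + t) (j + int q) = f i j)"

text \<open>A field chooses one edge at every first-class vertex by its very type; what remains of
  perfection is the condition at the second-class vertices.\<close>
definition matching :: "(int \<Rightarrow> int \<Rightarrow> dir) \<Rightarrow> bool" where
  "matching f \<longleftrightarrow> (\<forall>i j. \<exists>!d. f (i + dx d) (j + dy d) = d)"

text \<open>The three cells involved own the six sides of the hexagon centred at \<open>(i, j)\<close>, two each;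
  the two alternatives are the two ways in which these sides can alternate.\<close>
definition flippable :: "(int \<Rightarrow> int \<Rightarrow> dir) \<Rightarrow> int \<Rightarrow> int \<Rightarrow> bool" where
  "flippable f i j \<longleftrightarrow>
     f i j = NW \<and> f (i - 1) j = S \<and> f i (j - 1) = NE \<or>
     f i j = S \<and> f (i - 1) j = NE \<and> f i (j - 1) = NW"

lemma int_multiple_invariant:
  assumes "\<And>x. F (x + n) = F x"
  shows "F (x + k * n) = F (x::int)"
proof (induction k rule: int_induct[where k = 0])
  case (step1 k)
  then show ?case using assms[of "x + k * n"] by (simp add: algebra_simps)
next
  case (step2 k)
  then show ?case using assms[of "x + (k - 1) * n"] by (simp add: algebra_simps)
qed simp

lemma periodic_iff_lat_equiv: "periodic f \<longleftrightarrow> (\<forall>i j i' j'. lat_equiv i j i' j' \<longrightarrow> f i j = f i' j')"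
proof
  assume f: "periodic f"
  have 1: "f (i + a * int p) j = f i j" for i j a
    using f by (intro int_multiple_invariant[where F = "\<lambda>x. f x j"]) (simp add: periodic_def)
  have "f (i + (x + 1) * t) (j + (x + 1) * int q) = f (i + x * t) (j + x * int q)" for i j x
    using f[unfolded periodic_def, rule_format, of "i + x * t" "j + x * int q"]
    by (simp add: algebra_simps)
  then have 2: "f (i + b * t) (j + b * int q) = f i j" for i j b
    using int_multiple_invariant[of "\<lambda>x. f (i + x * t) (j + x * int q)" 1 0 b] by simp
  show "\<forall>i j i' j'. lat_equiv i j i' j' \<longrightarrow> f i j = f i' j'"
    unfolding lat_equiv_def using 1 2 by (auto simp flip: add.assoc)
next
  assume *: "\<forall>i j i' j'. lat_equiv i j i' j' \<longrightarrow> f i j = f i' j'"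
  have "lat_equiv i j (i + int p) j" for i j
    unfolding lat_equiv_def by (intro exI[of _ 1] exI[of _ 0]) simp
  moreover have "lat_equiv i j (i + t) (j + int q)" for i j
    unfolding lat_equiv_def by (intro exI[of _ 0] exI[of _ 1]) simp
  ultimately show "periodic f" using * unfolding periodic_def by metis
qed

definition edges_of :: "(int \<Rightarrow> int \<Rightarrow> dir) \<Rightarrow> point set set set" where
  "edges_of f = {edge i j (f i j) | i j. True}"

lemma edge_in_edges_of_iff:
  assumes "periodic f"
  shows "edge i j d \<in> edges_of f \<longleftrightarrow> f i j = d"
proof
  assume "edge i j d \<in> edges_of f"
  then obtain i' j' where "lat_equiv i j i' j'" "d = f i' j'"
    unfolding edges_of_def using edge_eq_iff by blast
  then show "f i j = d" using assms periodic_iff_lat_equiv by blast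
qed (auto simp: edges_of_def)

lemma alternating_face_edges_of:
  assumes "periodic f"
  shows "alternating_face p q t (edges_of f) i j \<longleftrightarrow> flippable f i j"
proof -
  have all6: "(\<forall>k<6. P k) \<longleftrightarrow> P 0 \<and> P (Suc 0) \<and> P 2 \<and> P 3 \<and> P 4 \<and> P (5::nat)" for P
    unfolding less_6_iff Ball_def[symmetric] ball_simps simp_thms ..
  have mods: "Suc 0 mod 6 = Suc 0" "Suc (Suc 0) mod 6 = 2" "Suc 2 mod 6 = 3" "Suc 3 mod 6 = 4"
    "Suc 4 mod 6 = 5" "Suc 5 mod 6 = 0"
    by simp_all
  show ?thesis
    unfolding alternating_face_def all6 mods face_edge_def hex_sides edge_def[symmetric]
      edge_in_edges_of_iff[OF assms] flippable_def
    by (cases "f i j"; cases "f (i - 1) j"; cases "f i (j - 1)") simp_all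
qed

lemma bij_betw_edges_of:
  "bij_betw edges_of {f. periodic f \<and> matching f \<and> (\<forall>i j. \<not> flippable f i j)}
     {M. trivial_perfect_matching p q t M}"
proof (rule bij_betw_imageI)
  show "inj_on edges_of {f. periodic f \<and> matching f \<and> (\<forall>i j. \<not> flippable f i j)}"
  proof (rule inj_onI, clarify)
    fix f g assume "periodic f" "periodic g" "edges_of f = edges_of g"
    then have "f i j = g i j" for i j
      using edge_in_edges_of_iff by metis
    then show "f = g" by blast
  qed
next
  show "edges_of ` {f. periodic f \<and> matching f \<and> (\<forall>i j. \<not> flippable f i j)} =
      {M. trivial_perfect_matching p q t M}"
  proof (intro equalityI subsetI)
    fix M assume "M \<in> edges_of ` {f. periodic f \<and> matching f \<and> (\<forall>i j. \<not> flippable f i j)}"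
    then obtain f where f: "periodic f" "matching f" "\<forall>i j. \<not> flippable f i j" "M = edges_of f"
      by blast
    have "M \<subseteq> tp_edges p q t" unfolding f(4) edges_of_def tp_edges_eq by blast
    then have "perfect_matching (tp_vertices p q t) (tp_edges p q t) M"
      using f(2) unfolding perfect_matching_iff f(4) edge_in_edges_of_iff[OF f(1)] matching_def
      by simp
    then show "M \<in> {M. trivial_perfect_matching p q t M}"
      using f(3) by (simp add: trivial_perfect_matching_def f(4) alternating_face_edges_of[OF f(1)])
  next
    fix M assume "M \<in> {M. trivial_perfect_matching p q t M}"
    then have pm: "perfect_matching (tp_vertices p q t) (tp_edges p q t) M"
      and alt: "\<And>i j. \<not> alternating_face p q t M i j"
      by (auto simp: trivial_perfect_matching_def)
    define f where "f = (\<lambda>i j. THE d. edge i j d \<in> M)"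
    note M_conds = pm[unfolded perfect_matching_iff]
    have ex1: "\<exists>!d. edge i j d \<in> M" for i j
      using M_conds[THEN conjunct2, THEN conjunct1] by simp
    have "edge i j (f i j) \<in> M" for i j
      unfolding f_def by (rule theI'[OF ex1])
    then have fM: "edge i j d \<in> M \<longleftrightarrow> f i j = d" for i j d
      using ex1[of i j] by metis
    have per: "periodic f"
      unfolding periodic_iff_lat_equiv
    proof (intro allI impI)
      fix i j i' j' assume "lat_equiv i j i' j'"
      then have "edge i j (f i' j') = edge i' j' (f i' j')" by (simp add: edge_eq_iff)
      then show "f i j = f i' j'" using fM by metis
    qed
    have M: "M = edges_of f"
    proof -
      have "e \<in> M \<longleftrightarrow> e \<in> edges_of f" if "e \<in> tp_edges p q t" for e
      proof -
        obtain i j d where "e = edge i j d" using \<open>e \<in> tp_edges p q t\<close> unfolding tp_edges_eq by blast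
        then show ?thesis using edge_in_edges_of_iff[OF per] fM by simp
      qed
      moreover have "M \<subseteq> tp_edges p q t" using M_conds by simp
      moreover have "edges_of f \<subseteq> tp_edges p q t" unfolding edges_of_def tp_edges_eq by blast
      ultimately show ?thesis by blast
    qed
    have "matching f"
      using M_conds unfolding fM matching_def by simp
    then show "M \<in> edges_of ` {f. periodic f \<and> matching f \<and> (\<forall>i j. \<not> flippable f i j)}"
      using per alt unfolding M alternating_face_edges_of[OF per] by blast
  qed
qed

section \<open>Direction fields without flippable hexagons miss a direction\<close>

lemma matching_iff:
  "matching f \<longleftrightarrow> (\<forall>i j.
     (f i j = NE \<or> f (i + 1) j = NW \<or> f i (j + 1) = S) \<and>
     \<not> (f i j = NE \<and> f (i + 1) j = NW) \<and>
     \<not> (f i j = NE \<and> f i (j + 1) = S) \<and>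
     \<not> (f (i + 1) j = NW \<and> f i (j + 1) = S))"
proof -
  have "(\<exists>!d. P d) \<longleftrightarrow> (P NE \<or> P NW \<or> P S) \<and> \<not> (P NE \<and> P NW) \<and> \<not> (P NE \<and> P S) \<and> \<not> (P NW \<and> P S)"
    for P by (metis dir.exhaust dir.distinct)
  then show ?thesis unfolding matching_def by simp
qed

text \<open>On a cycle, a property that passes to the next element holds everywhere or nowhere.
  This replaces every two-sided propagation argument below.\<close>
lemma invariant_of_periodic:
  fixes P :: "int \<Rightarrow> bool"
  assumes step: "\<And>n. P n \<Longrightarrow> P (n + 1)" and per: "\<And>n. P (n + N) = P n" and "N > 0" and "P m"
  shows "P n"
proof -
  have fwd: "P k" if "k \<ge> m" for k
    using that by (induction rule: int_ge_induct) (auto intro: \<open>P m\<close> step)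
  have "n + \<bar>m - n\<bar> * N \<ge> n + \<bar>m - n\<bar> * 1"
    using \<open>N > 0\<close> by (intro add_left_mono mult_left_mono) auto
  moreover have "m \<le> n + \<bar>m - n\<bar> * 1" by simp
  ultimately have "P (n + \<bar>m - n\<bar> * N)" by (intro fwd) (rule order_trans)
  then show "P n" using int_multiple_invariant[of P N n, OF per] by simp
qed

context
  fixes f :: "int \<Rightarrow> int \<Rightarrow> dir"
  assumes per: "periodic f" and mat: "matching f"
begin

text \<open>The vector \<open>(pq, -pq)\<close> is \<open>q + t\<close> times \<open>(p, 0)\<close> minus \<open>p\<close> times \<open>(t, q)\<close>,
  so every antidiagonal closes up in the quotient.\<close>
lemma antidiagonal_period: "f (i + int p * int q) (j - int p * int q) = f i j"
proof -
  have "lat_equiv i j (i + int p * int q) (j - int p * int q)"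
    unfolding lat_equiv_def
    by (intro exI[of _ "int q + t"] exI[of _ "- int p"]) (simp add: algebra_simps)
  then show ?thesis using per periodic_iff_lat_equiv by metis
qed

lemma antidiagonal_invariant:
  assumes step: "\<And>i j. i + j = s \<Longrightarrow> P (f i j) \<Longrightarrow> P (f (i + 1) (j - 1))"
    and P: "P (f i j)" and s: "i + j = s" "i' + j' = s"
  shows "P (f i' j')"
proof -
  have "P (f i' (s - i'))"
  proof (rule invariant_of_periodic[where P = "\<lambda>n. P (f n (s - n))"])
    show "P (f (n + 1) (s - (n + 1)))" if "P (f n (s - n))" for n
      using step[OF _ that] by (simp add: algebra_simps)
    show "P (f (n + int p * int q) (s - (n + int p * int q))) = P (f n (s - n))" for n
      using antidiagonal_period[of n "s - n"] by (simp add: algebra_simps)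
    show "int p * int q > 0" using p2 q2 by simp
    show "P (f i (s - i))" using P by (simp flip: s(1))
  qed
  then show ?thesis by (simp flip: s(2))
qed

text \<open>If an antidiagonal has no \<open>NE\<close>, then on the next one every value other than \<open>S\<close> is
  followed, going down, by \<open>NW\<close>. A value \<open>NE\<close> would thus be followed by \<open>NW\<close> forever, although
  the antidiagonal is a cycle that returns to it.\<close>
lemma no_NE_next_antidiagonal:
  assumes "\<And>i j. i + j = s \<Longrightarrow> f i j \<noteq> NE" and "i + j = s + 1"
  shows "f i j \<noteq> NE"
proof
  assume NE: "f i j = NE"
  have step: "f (i + 1) (j - 1) = NW" if "i + j = s + 1" "f i j \<noteq> S" for i j
    using mat[unfolded matching_iff, rule_format, of i "j - 1"] assms(1)[of i "j - 1"] that by auto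
  have "f (i + 1) (j - 1) = NW" using step assms(2) NE by simp
  then have "f i j = NW"
    using antidiagonal_invariant[where P = "\<lambda>d. d = NW" and s = "s + 1" and i = "i + 1"
        and j = "j - 1" and i' = i and j' = j] step assms(2) by simp
  then show False using NE by simp
qed

lemma no_NE_anywhere:
  assumes "\<And>i j. i + j = s \<Longrightarrow> f i j \<noteq> NE"
  shows "f i j \<noteq> NE"
proof -
  have "\<forall>i j. i + j = n \<longrightarrow> f i j \<noteq> NE" for n
  proof (rule invariant_of_periodic[where P = "\<lambda>n. \<forall>i j. i + j = n \<longrightarrow> f i j \<noteq> NE"])
    show "\<forall>i j. i + j = n + 1 \<longrightarrow> f i j \<noteq> NE" if "\<forall>i j. i + j = n \<longrightarrow> f i j \<noteq> NE" for n
      using no_NE_next_antidiagonal[of n] that by blast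
    show "(\<forall>i j. i + j = n + int p \<longrightarrow> f i j \<noteq> NE) \<longleftrightarrow> (\<forall>i j. i + j = n \<longrightarrow> f i j \<noteq> NE)" for n
    proof -
      have "f (i - int p) j = f i j" "f (i + int p) j = f i j" for i j
        using per[unfolded periodic_def, rule_format, of "i - int p" j]
          per[unfolded periodic_def, rule_format, of i j] by simp_all
      moreover have "(i - int p) + j = n" if "i + j = n + int p" for i j using that by simp
      moreover have "(i + int p) + j = n + int p" if "i + j = n" for i j using that by simp
      ultimately show ?thesis by metis
    qed
    show "int p > 0" using p2 by simp
    show "\<forall>i j. i + j = s \<longrightarrow> f i j \<noteq> NE" using assms by blast
  qed
  then show ?thesis by blast
qed

text \<open>Consider \<open>S\<close> at \<open>(i, j)\<close> and \<open>NW\<close> at \<open>(i + 1, j)\<close>. At \<open>(i + 1, j - 1)\<close>, the value \<open>NE\<close>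
  would make a hexagon flippable and \<open>NW\<close> would cover a vertex twice, so it is \<open>S\<close>; the next
  vertex then forces \<open>NW\<close> at \<open>(i + 2, j - 1)\<close>. The pair thus descends along the antidiagonal,
  and no \<open>NE\<close> lies on it.\<close>
lemma no_NE_if_S_before_NW:
  assumes flip: "\<And>i j. \<not> flippable f i j" and "f i j = S" "f (i + 1) j = NW"
  shows "f i' j' \<noteq> NE"
proof -
  have step: "f (i + 1) (j - 1) = S \<and> f (i + 2) (j - 1) = NW"
    if "f i j = S" "f (i + 1) j = NW" for i j
  proof -
    have "f (i + 1) (j - 1) \<noteq> NE" using flip[of "i + 1" j] that by (auto simp: flippable_def)
    moreover have "f (i + 1) (j - 1) \<noteq> NW"
      using mat[unfolded matching_iff, rule_format, of i "j - 1"] that by auto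
    ultimately have S: "f (i + 1) (j - 1) = S" by (cases "f (i + 1) (j - 1)") auto
    then show ?thesis
      using mat[unfolded matching_iff, rule_format, of "i + 1" "j - 1"] that
      by (simp add: algebra_simps)
  qed
  have "f n (i + j - n) = S \<and> f (n + 1) (i + j - n) = NW" for n
  proof (rule invariant_of_periodic[where
        P = "\<lambda>n. f n (i + j - n) = S \<and> f (n + 1) (i + j - n) = NW"])
    show "f (n + 1) (i + j - (n + 1)) = S \<and> f (n + 1 + 1) (i + j - (n + 1)) = NW"
      if "f n (i + j - n) = S \<and> f (n + 1) (i + j - n) = NW" for n
      using step[of n "i + j - n"] that by (simp add: algebra_simps)
    show "(f (n + int p * int q) (i + j - (n + int p * int q)) = S \<and>
        f (n + int p * int q + 1) (i + j - (n + int p * int q)) = NW) \<longleftrightarrow>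
        (f n (i + j - n) = S \<and> f (n + 1) (i + j - n) = NW)" for n
      using antidiagonal_period[of n "i + j - n"] antidiagonal_period[of "n + 1" "i + j - n"]
      by (simp add: algebra_simps)
    show "int p * int q > 0" using p2 q2 by simp
    show "f i (i + j - i) = S \<and> f (i + 1) (i + j - i) = NW" using assms by simp
  qed
  then have S: "f n (i + j - n) = S" for n by blast
  have "f k l \<noteq> NE" if "k + l = i + j" for k l
    using S[of k] by (simp flip: that)
  then show ?thesis using no_NE_anywhere by blast
qed

text \<open>The cell before a \<open>NW\<close> cannot hold \<open>NE\<close> by the matching condition, nor \<open>S\<close> by
  hypothesis; so \<open>NW\<close> spreads to the left around the row.\<close>
lemma row_NW_or_no_NW:
  assumes "\<And>i. f i j = S \<Longrightarrow> f (i + 1) j \<noteq> NW" and "f i j = NW"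
  shows "f i' j = NW"
proof -
  have "f (- (- i')) j = NW"
  proof (rule invariant_of_periodic[where P = "\<lambda>n. f (- n) j = NW"])
    \<comment> \<open>The propagation goes to the left, hence the reflected index.\<close>
    show "f (- (n + 1)) j = NW" if "f (- n) j = NW" for n
    proof -
      have "f (- n - 1) j = NW"
        using mat[unfolded matching_iff, rule_format, of "- n - 1" j] assms(1)[of "- n - 1"] that
        by (cases "f (- n - 1) j") auto
      then show ?thesis by simp
    qed
    show "(f (- (n + int p)) j = NW) \<longleftrightarrow> (f (- n) j = NW)" for n
      using per[unfolded periodic_def, rule_format, of "- n - int p" j] by (simp add: algebra_simps)
    show "int p > 0" using p2 by simp
    show "f (- (- i)) j = NW" using assms by simp
  qed
  then show ?thesis by simp
qed

text \<open>An \<open>S\<close> in the next row needs a cell below it with \<open>NW\<close> whose right neighbour is not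
  \<open>NW\<close>, which a row without \<open>S\<close> does not have.\<close>
lemma no_S_next_row:
  assumes "\<And>i. f i j \<noteq> S"
  shows "f i (j + 1) \<noteq> S"
proof
  assume S: "f i (j + 1) = S"
  then have "f i j = NW" "f (i + 1) j \<noteq> NW"
    using mat[unfolded matching_iff, rule_format, of i j] assms[of i] by (cases "f i j"; auto)+
  then show False using row_NW_or_no_NW[of j i "i + 1"] assms by blast
qed

lemma no_S_anywhere:
  assumes "\<And>i. f i j \<noteq> S"
  shows "f i' j' \<noteq> S"
proof -
  have "\<forall>i. f i j' \<noteq> S"
  proof (rule invariant_of_periodic[where P = "\<lambda>n. \<forall>i. f i n \<noteq> S"])
    show "\<forall>i. f i (n + 1) \<noteq> S" if "\<forall>i. f i n \<noteq> S" for n using no_S_next_row that by blast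
    show "(\<forall>i. f i (n + int q) \<noteq> S) \<longleftrightarrow> (\<forall>i. f i n \<noteq> S)" for n
      using per unfolding periodic_def by (metis diff_add_cancel)
    show "int q > 0" using q2 by simp
    show "\<forall>i. f i j \<noteq> S" using assms by blast
  qed
  then show ?thesis by blast
qed

lemma unflippable_iff_misses_dir:
  "(\<forall>i j. \<not> flippable f i j) \<longleftrightarrow> (\<exists>c. \<forall>i j. f i j \<noteq> c)"
proof
  assume flip: "\<forall>i j. \<not> flippable f i j"
  show "\<exists>c. \<forall>i j. f i j \<noteq> c"
  proof (cases "\<exists>i j. f i j = S \<and> f (i + 1) j = NW")
    case True
    then show ?thesis using no_NE_if_S_before_NW flip by blast
  next
    case False
    show ?thesis
    proof (cases "\<exists>i j. f i j = NW")
      case True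
      then obtain i j where "f i j = NW" by blast
      then have "f i' j \<noteq> S" for i' using row_NW_or_no_NW[of j i i'] False by auto
      then show ?thesis using no_S_anywhere by blast
    qed blast
  qed
next
  assume "\<exists>c. \<forall>i j. f i j \<noteq> c"
  then obtain c where "\<And>i j. f i j \<noteq> c" by blast
  then show "\<forall>i j. \<not> flippable f i j"
    by (cases c) (simp_all add: flippable_def)
qed

end

section \<open>Counting\<close>

definition missing :: "dir \<Rightarrow> (int \<Rightarrow> int \<Rightarrow> dir) set" where
  "missing c = {f. periodic f \<and> matching f \<and> (\<forall>i j. f i j \<noteq> c)}"

definition periodic_sets :: "int \<Rightarrow> (int \<Rightarrow> bool) set" where
  "periodic_sets n = {G. \<forall>x. G (x + n) = G x}"

lemma card_periodic_sets:
  assumes "n > 0"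
  shows "card (periodic_sets n) = 2 ^ nat n"
proof -
  have mod: "G (x mod n) = G x" if "G \<in> periodic_sets n" for G x
    using int_multiple_invariant[of G n "x mod n" "x div n"] that
    by (simp add: periodic_sets_def)
  have "bij_betw (\<lambda>G. {x \<in> {0..<n}. G x}) (periodic_sets n) (Pow {0..<n})"
  proof (rule bij_betw_imageI)
    show "inj_on (\<lambda>G. {x \<in> {0..<n}. G x}) (periodic_sets n)"
    proof (rule inj_onI)
      fix G H assume G: "G \<in> periodic_sets n" and H: "H \<in> periodic_sets n"
        and eq: "{x \<in> {0..<n}. G x} = {x \<in> {0..<n}. H x}"
      have "G x = H x" for x
      proof -
        have "x mod n \<in> {0..<n}" using assms by simp
        then have "G (x mod n) = H (x mod n)" using eq by blast
        then show ?thesis using mod[OF G] mod[OF H] by simp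
      qed
      then show "G = H" by blast
    qed
    show "(\<lambda>G. {x \<in> {0..<n}. G x}) ` periodic_sets n = Pow {0..<n}"
    proof (intro equalityI subsetI)
      fix A assume "A \<in> Pow {0..<n}"
      then have sub: "\<And>x. x \<in> A \<Longrightarrow> 0 \<le> x \<and> x < n" by auto
      show "A \<in> (\<lambda>G. {x \<in> {0..<n}. G x}) ` periodic_sets n"
      proof (rule image_eqI)
        show "A = {x \<in> {0..<n}. x mod n \<in> A}"
          using sub by (intro set_eqI) (auto simp: mod_pos_pos_trivial)
        show "(\<lambda>x. x mod n \<in> A) \<in> periodic_sets n" by (simp add: periodic_sets_def)
      qed
    qed auto
  qed
  then have "card (periodic_sets n) = card (Pow {0..<n})" by (rule bij_betw_same_card)
  then show ?thesis by (simp add: card_Pow)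
qed

text \<open>By Bezout, two periods have their gcd as a period.\<close>
lemma periodic_sets_gcd: "periodic_sets m \<inter> periodic_sets n = periodic_sets (gcd m n)"
proof (intro equalityI subsetI)
  fix G assume G: "G \<in> periodic_sets m \<inter> periodic_sets n"
  obtain u v where uv: "u * m + v * n = gcd m n" using bezout_int by blast
  have "G (x + gcd m n) = G x" for x
  proof -
    have "G (x + gcd m n) = G (x + u * m + v * n)" by (simp add: uv[symmetric] algebra_simps)
    also have "\<dots> = G (x + u * m)"
      using G by (intro int_multiple_invariant) (simp add: periodic_sets_def)
    also have "\<dots> = G x"
      using G by (intro int_multiple_invariant) (simp add: periodic_sets_def)
    finally show ?thesis .
  qed
  then show "G \<in> periodic_sets (gcd m n)" by (simp add: periodic_sets_def)
next
  fix G assume G: "G \<in> periodic_sets (gcd m n)"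
  have "G (x + k) = G x" if "gcd m n dvd k" for x k
  proof -
    obtain l where "k = gcd m n * l" using \<open>gcd m n dvd k\<close> by (rule dvdE)
    then show ?thesis
      using int_multiple_invariant[of G "gcd m n" x l] G
      by (simp add: periodic_sets_def mult.commute[of l])
  qed
  then show "G \<in> periodic_sets m \<inter> periodic_sets n" by (simp add: periodic_sets_def)
qed

text \<open>A family of two-valued fields that are constant on the level sets of \<open>u\<close>, with the value on
  the level \<open>s\<close> chosen freely subject to a period of \<open>s\<close>; the pair \<open>(v s, w s)\<close> is
  a representative of the level, from which the choice is read off.\<close>
lemma card_striped:
  assumes "n > 0" "a \<noteq> b" and uvw: "\<And>s. u (v s) (w s) = s"
    and "\<And>G. G \<in> periodic_sets n \<Longrightarrow> (\<lambda>i j. if G (u i j) then a else b) \<in> A"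
    and "\<And>f. f \<in> A \<Longrightarrow> (\<lambda>s. f (v s) (w s) = a) \<in> periodic_sets n"
    and "\<And>f i j. f \<in> A \<Longrightarrow> f i j = (if f (v (u i j)) (w (u i j)) = a then a else b)"
  shows "card A = 2 ^ nat n"
proof -
  have "bij_betw (\<lambda>G i j. if G (u i j) then a else b) (periodic_sets n) A"
  proof (rule bij_betw_byWitness[where f' = "\<lambda>f s. f (v s) (w s) = a"])
    show "\<forall>G \<in> periodic_sets n. (\<lambda>s. (if G (u (v s) (w s)) then a else b) = a) = G"
      using assms(2) by (auto simp: uvw)
    show "\<forall>f \<in> A. (\<lambda>i j. if f (v (u i j)) (w (u i j)) = a then a else b) = f"
      by (intro ballI ext) (rule assms(6)[symmetric])
  qed (use assms(4,5) in blast)+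
  then have "card (periodic_sets n) = card A" by (rule bij_betw_same_card)
  then show ?thesis using card_periodic_sets[OF assms(1)] by simp
qed

lemma card_missing_S: "card (missing S) = 2 ^ q"
proof -
  have "card (missing S) = 2 ^ nat (int q)"
  proof (rule card_striped[where u = "\<lambda>i j. j" and v = "\<lambda>s. 0" and w = "\<lambda>s. s"])
    show "(\<lambda>i j. if G j then NE else NW) \<in> missing S" if "G \<in> periodic_sets (int q)" for G
      using that by (auto simp: missing_def periodic_def matching_iff periodic_sets_def)
  next
    fix f assume "f \<in> missing S"
    then have per: "f (i + int p) j = f i j" "f (i + t) (j + int q) = f i j" and mat: "matching f"
      and no: "f i j \<noteq> S" for i j
      by (simp_all add: missing_def periodic_def)
    have "f (i + 1) j = f i j" for i j
      using mat[unfolded matching_iff, rule_format, of i j] no[of i j] no[of "i + 1" j] no[of i "j + 1"]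
      by (cases "f i j"; cases "f (i + 1) j") simp_all
    then have row: "f i j = f 0 j" for i j
      using int_multiple_invariant[of "\<lambda>i. f i j" 1 0 i] by simp
    have "f 0 (s + int q) = f 0 s" for s
      using per(2)[of 0 s] row[of t] by simp
    then show "(\<lambda>s. f 0 s = NE) \<in> periodic_sets (int q)" by (simp add: periodic_sets_def)
    show "f i j = (if f 0 j = NE then NE else NW)" for i j
      using no[of i j] row[of i j] by (cases "f i j") simp_all
  qed (use q2 in auto)
  then show ?thesis by simp
qed

lemma card_missing_NW: "card (missing NW) = 2 ^ nat (gcd (int p) t)"
proof (rule card_striped[where u = "\<lambda>i j. i" and v = "\<lambda>s. s" and w = "\<lambda>s. 0"])
  show "(\<lambda>i j. if G i then NE else S) \<in> missing NW" if "G \<in> periodic_sets (gcd (int p) t)" for G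
    using that unfolding periodic_sets_gcd[symmetric]
    by (auto simp: missing_def periodic_def matching_iff periodic_sets_def)
next
  fix f assume "f \<in> missing NW"
  then have per: "f (i + int p) j = f i j" "f (i + t) (j + int q) = f i j" and mat: "matching f"
    and no: "f i j \<noteq> NW" for i j
    by (simp_all add: missing_def periodic_def)
  have "f i (j + 1) = f i j" for i j
    using mat[unfolded matching_iff, rule_format, of i j] no[of i j] no[of "i + 1" j] no[of i "j + 1"]
    by (cases "f i j"; cases "f i (j + 1)") simp_all
  then have col: "f i j = f i 0" for i j
    using int_multiple_invariant[of "\<lambda>j. f i j" 1 0 j] by simp
  have "f (s + int p) 0 = f s 0" "f (s + t) 0 = f s 0" for s
    using per(1)[of s 0] per(2)[of s 0] col[of "s + t" "int q"] by simp_all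
  then show "(\<lambda>s. f s 0 = NE) \<in> periodic_sets (gcd (int p) t)"
    unfolding periodic_sets_gcd[symmetric] by (simp add: periodic_sets_def)
  show "f i j = (if f i 0 = NE then NE else S)" for i j
    using no[of i j] col[of i j] by (cases "f i j") simp_all
qed (use p2 in auto)

lemma card_missing_NE: "card (missing NE) = 2 ^ nat (gcd (int p) (int q + t))"
proof (rule card_striped[where u = "\<lambda>i j. i + j" and v = "\<lambda>s. s" and w = "\<lambda>s. 0"])
  fix G assume "G \<in> periodic_sets (gcd (int p) (int q + t))"
  then have G: "G (x + int p) = G x" "G (x + (int q + t)) = G x" for x
    unfolding periodic_sets_gcd[symmetric] by (auto simp: periodic_sets_def)
  have "G (i + int p + j) = G (i + j)" "G (i + t + (j + int q)) = G (i + j)"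
    "G (i + 1 + j) = G (i + (j + 1))" for i j
    using G(1)[of "i + j"] G(2)[of "i + j"] by (simp_all add: algebra_simps)
  then show "(\<lambda>i j. if G (i + j) then NW else S) \<in> missing NE"
    by (auto simp: missing_def periodic_def matching_iff)
next
  fix f assume "f \<in> missing NE"
  then have per: "f (i + int p) j = f i j" "f (i + t) (j + int q) = f i j" and mat: "matching f"
    and no: "f i j \<noteq> NE" for i j
    by (simp_all add: missing_def periodic_def)
  have step: "f (i + 1) j = f i (j + 1)" for i j
    using mat[unfolded matching_iff, rule_format, of i j] no[of i j] no[of "i + 1" j] no[of i "j + 1"]
    by (cases "f (i + 1) j"; cases "f i (j + 1)") simp_all
  have "f (i + (k + 1)) (j - (k + 1)) = f (i + k) (j - k)" for i j k
    using step[of "i + k" "j - (k + 1)"] by (simp add: add.assoc)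
  then have diag: "f i j = f (i + j) 0" for i j
    using int_multiple_invariant[of "\<lambda>k. f (i + k) (j - k)" 1 0 j] by simp
  have "f (s + int p) 0 = f s 0" "f (s + (int q + t)) 0 = f s 0" for s
    using per(1)[of s 0] per(2)[of s 0] diag[of "s + t" "int q"] by (simp_all add: ac_simps)
  then show "(\<lambda>s. f s 0 = NW) \<in> periodic_sets (gcd (int p) (int q + t))"
    unfolding periodic_sets_gcd[symmetric] by (simp add: periodic_sets_def)
  show "f i j = (if f (i + j) 0 = NW then NW else S)" for i j
    using no[of i j] diag[of i j] by (cases "f i j") simp_all
qed (use p2 in auto)

lemma missing_Int:
  assumes "{c, d, e} = UNIV" "c \<noteq> d"  "c \<noteq> e" "d \<noteq> e"
  shows "missing c \<inter> missing d = {\<lambda>_ _. e}"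
proof (intro equalityI subsetI)
  fix f assume "f \<in> missing c \<inter> missing d"
  then have "f i j = e" for i j using assms(1) unfolding missing_def by blast
  then show "f \<in> {\<lambda>_ _. e}" by blast
next
  have "matching (\<lambda>_ _. e)" "periodic (\<lambda>_ _. e)" by (auto simp: matching_def periodic_def)
  then show "f \<in> missing c \<inter> missing d" if "f \<in> {\<lambda>_ _. e}" for f
    using that assms by (auto simp: missing_def)
qed

lemma card_trivial:
  "int (card {M. trivial_perfect_matching p q t M}) =
     2 ^ q + 2 ^ nat (gcd (int p) t) + 2 ^ nat (gcd (int p) (int q + t)) - 3"
proof -
  have dirs: "(\<exists>c. P c) \<longleftrightarrow> P S \<or> P NW \<or> P NE" for P
    by (metis dir.exhaust)
  have "{f. periodic f \<and> matching f \<and> (\<forall>i j. \<not> flippable f i j)} =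
      {f. periodic f \<and> matching f \<and> (\<exists>c. \<forall>i j. f i j \<noteq> c)}"
    by (intro Collect_cong conj_cong refl) (rule unflippable_iff_misses_dir)
  also have "\<dots> = missing S \<union> missing NW \<union> missing NE"
    unfolding missing_def dirs by blast
  finally have card: "card {M. trivial_perfect_matching p q t M} =
      card (missing S \<union> missing NW \<union> missing NE)"
    using bij_betw_same_card[OF bij_betw_edges_of] by simp
  have fin: "finite (missing S)" "finite (missing NW)" "finite (missing NE)"
    using card_missing_S card_missing_NW card_missing_NE by (simp_all add: card_ge_0_finite)
  have UNIV_dir: "d \<in> {S, NW, NE}" for d by (cases d) auto
  have "missing S \<inter> missing NW = {\<lambda>_ _. NE}"
    by (rule missing_Int) (use UNIV_dir in auto)
  then have "card (missing S \<union> missing NW) + 1 = card (missing S) + card (missing NW)"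
    using card_Un_Int[OF fin(1,2)] by simp
  moreover have "(missing S \<union> missing NW) \<inter> missing NE = {\<lambda>_ _. NW, \<lambda>_ _. S}"
  proof -
    have "missing S \<inter> missing NE = {\<lambda>_ _. NW}" "missing NW \<inter> missing NE = {\<lambda>_ _. S}"
      by (rule missing_Int; use UNIV_dir in auto)+
    then show ?thesis by blast
  qed
  moreover have "card {\<lambda>(_::int) (_::int). NW, \<lambda>_ _. S} = 2"
    by (auto simp: card_insert_if fun_eq_iff)
  ultimately have "card (missing S \<union> missing NW \<union> missing NE) + 3 =
      card (missing S) + card (missing NW) + card (missing NE)"
    using card_Un_Int[of "missing S \<union> missing NW" "missing NE"] fin by simp
  then have "int (card (missing S \<union> missing NW \<union> missing NE)) + 3 =
      int (card (missing S)) + int (card (missing NW)) + int (card (missing NE))"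
    by linarith
  then show ?thesis unfolding card card_missing_S card_missing_NW card_missing_NE by simp
qed

end

text \<open>With \<open>d = gcd p s\<close>, the condition \<open>p dvd n * s\<close> is \<open>p / d dvd n * (s / d)\<close>, that is
  \<open>p / d dvd n\<close> by coprimality; so the least \<open>n\<close> is \<open>p / d\<close>.\<close>
lemma div_least_annihilator:
  assumes "p > 0"
  shows "p div (LEAST n. n > 0 \<and> [int n * s = 0] (mod int p)) = nat (gcd (int p) s)"
proof -
  define d where "d = gcd (int p) s"
  have d: "d > 0" using assms by (simp add: d_def)
  define m where "m = nat (int p div d)"
  have "d dvd int p" by (simp add: d_def)
  then have pm: "int p = d * int m"
    using d by (simp add: m_def pos_imp_zdiv_nonneg_iff)
  obtain s' where s: "s = d * s'" unfolding d_def by (meson dvdE gcd_dvd2)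
  have "gcd (d * int m) (d * s') = d" using pm s d_def by metis
  then have "d * gcd (int m) s' = d * 1" using d by (simp add: gcd_mult_left)
  then have cop: "coprime (int m) s'" using d by (simp add: coprime_iff_gcd_eq_1)
  have "[int n * s = 0] (mod int p) \<longleftrightarrow> m dvd n" for n
  proof -
    have "[int n * s = 0] (mod int p) \<longleftrightarrow> d * int m dvd d * (int n * s')"
      by (simp add: cong_0_iff pm s algebra_simps)
    also have "\<dots> \<longleftrightarrow> int m dvd int n * s'" using d by simp
    also have "\<dots> \<longleftrightarrow> m dvd n" using cop by (simp add: coprime_dvd_mult_left_iff)
    finally show ?thesis .
  qed
  moreover have m: "m > 0" using assms pm by (cases m) auto
  ultimately have "(LEAST n. n > 0 \<and> [int n * s = 0] (mod int p)) = m"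
    by (intro Least_equality) (auto intro: dvd_imp_le)
  moreover have "p div m = nat d"
  proof -
    have "int (p div m) = d" using pm m by (simp add: zdiv_int)
    then show ?thesis by simp
  qed
  ultimately show ?thesis by (simp add: d_def)
qed

theorem mainTheorem4:
  fixes p q :: nat and t :: int and g g' :: nat
  assumes "p \<ge> 2" and "q \<ge> 2"
    and "g = (LEAST n. n > 0 \<and> [int n * t = 0] (mod int p))"
    and "g' = (LEAST n. n > 0 \<and> [int n * (int q + t) = 0] (mod int p))"
  shows "int (card {M. trivial_perfect_matching p q t M}) =
           2 ^ q + 2 ^ (p div g) + 2 ^ (p div g') - 3"
proof -
  interpret polyhex p q t by unfold_locales (use assms in auto)
  have "p div g = nat (gcd (int p) t)" "p div g' = nat (gcd (int p) (int q + t))"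
    unfolding assms(3,4) using assms(1) by (simp_all add: div_least_annihilator)
  then show ?thesis using card_trivial by simp
qed

end
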